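(* MLCM-P\_PATH can be solved (an optimal layout computed) in $O^*(2^{|\mathcal L|})$ time, i.e. in time $2^{|\mathcal L|}$ multiplied by a polynomial in the input size.
   Context: Stations $1,\dots,n$ lie on a horizontal line, joined by edges $(i,i+1)$. A line is $[i,j]$ with $1\le i<j\le n$, travelling along edges $(i,i+1),\dots,(j-1,j)$; $\mathcal L$ is a finite set of pairwise distinct lines; $\mathcal L_{i,i+1}$ is the set of lines traversing edge $(i,i+1)$; $[a,b]$ passes through station $i$ if $a<i<b$. A layout specifies, for every edge, a top-to-bottom order of its lines at each of its two ends; two lines cross on an edge if their orders differ at the two ends; the crossing number counts (pair, edge) crossings. Admissible: lines passing through station $i$ keep the same relative order at the station-$i$ ends of edges $(i-1,i)$ and $(i,i+1)$. Periphery condition: each line $[a,b]$ is above all or below all lines passing through $a$ at the station-$a$ end of $(a,a+1)$, and above all or below all lines passing through $b$ at the station-$b$ end of $(b-1,b)$. MLCM-P\_PATH: given $n$ and $\mathcal L$, find an admissible layout satisfying the periphery condition with minimum crossing number. *)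

theory Defs
  imports "HOL-Computational_Algebra.Polynomial"
begin

section \<open>Lines on a path and their layouts\<close>

text \<open>The line $[a,b]$ is the pair \<open>(a, b)\<close>; the edge $(i,i+1)$ is named by its left
  station \<open>i\<close>.\<close>

type_synonym line = "nat \<times> nat"

definition mlcm_instance :: "nat \<Rightarrow> line set \<Rightarrow> bool" where
  "mlcm_instance n L \<longleftrightarrow> finite L \<and> (\<forall>(a, b) \<in> L. 1 \<le> a \<and> a < b \<and> b \<le> n)"

definition edges :: "nat \<Rightarrow> nat set" where
  "edges n = {1..<n}"

definition lines_on :: "line set \<Rightarrow> nat \<Rightarrow> line set" where
  "lines_on L i = {(a, b) \<in> L. a \<le> i \<and> i + 1 \<le> b}"

definition passes_through :: "line \<Rightarrow> nat \<Rightarrow> bool" where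
  "passes_through l i \<longleftrightarrow> fst l < i \<and> i < snd l"

text \<open>A layout maps edge $(i,i+1)$ to the top-to-bottom orders of its lines at the
  station-$i$ end (first component) and at the station-$(i+1)$ end (second component).
  Its values outside \<open>edges n\<close> are irrelevant.\<close>

type_synonym layout = "nat \<Rightarrow> line list \<times> line list"

definition left_end :: "layout \<Rightarrow> nat \<Rightarrow> line list" where
  "left_end lay i = fst (lay i)"

definition right_end :: "layout \<Rightarrow> nat \<Rightarrow> line list" where
  "right_end lay i = snd (lay i)"

definition is_layout :: "nat \<Rightarrow> line set \<Rightarrow> layout \<Rightarrow> bool" where
  "is_layout n L lay \<longleftrightarrow>
     (\<forall>i \<in> edges n.
        distinct (left_end lay i) \<and> set (left_end lay i) = lines_on L i \<and>
        distinct (right_end lay i) \<and> set (right_end lay i) = lines_on L i)"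

definition above :: "line list \<Rightarrow> line \<Rightarrow> line \<Rightarrow> bool" where
  "above xs l m \<longleftrightarrow> (\<exists>i j. i < j \<and> j < length xs \<and> xs ! i = l \<and> xs ! j = m)"

definition cross :: "layout \<Rightarrow> nat \<Rightarrow> line \<Rightarrow> line \<Rightarrow> bool" where
  "cross lay i l m \<longleftrightarrow> above (left_end lay i) l m \<noteq> above (right_end lay i) l m"

definition crossing_number :: "nat \<Rightarrow> line set \<Rightarrow> layout \<Rightarrow> nat" where
  "crossing_number n L lay =
     card {({l, m}, i) | l m i.
       i \<in> edges n \<and> l \<in> lines_on L i \<and> m \<in> lines_on L i \<and> l \<noteq> m \<and> cross lay i l m}"

definition admissible :: "nat \<Rightarrow> line set \<Rightarrow> layout \<Rightarrow> bool" where
  "admissible n L lay \<longleftrightarrow>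
     (\<forall>i. 1 < i \<and> i < n \<longrightarrow>
       (\<forall>l \<in> L. \<forall>m \<in> L. passes_through l i \<and> passes_through m i \<longrightarrow>
          (above (right_end lay (i - 1)) l m \<longleftrightarrow> above (left_end lay i) l m)))"

definition extremal :: "line list \<Rightarrow> line \<Rightarrow> line set \<Rightarrow> bool" where
  "extremal xs l M \<longleftrightarrow> (\<forall>m \<in> M. above xs l m) \<or> (\<forall>m \<in> M. above xs m l)"

definition periphery_condition :: "line set \<Rightarrow> layout \<Rightarrow> bool" where
  "periphery_condition L lay \<longleftrightarrow>
     (\<forall>(a, b) \<in> L.
        extremal (left_end lay a) (a, b) {m \<in> L. passes_through m a} \<and>
        extremal (right_end lay (b - 1)) (a, b) {m \<in> L. passes_through m b})"

definition mlcm_p_feasible :: "nat \<Rightarrow> line set \<Rightarrow> layout \<Rightarrow> bool" where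
  "mlcm_p_feasible n L lay \<longleftrightarrow>
     is_layout n L lay \<and> admissible n L lay \<and> periphery_condition L lay"

definition mlcm_p_optimal :: "nat \<Rightarrow> line set \<Rightarrow> layout \<Rightarrow> bool" where
  "mlcm_p_optimal n L lay \<longleftrightarrow> is_arg_min (crossing_number n L) (mlcm_p_feasible n L) lay"


section \<open>Model of computation\<close>

text \<open>Programs are written in a first-order, call-by-value functional language over binary
  trees (pure Lisp, as in N. D. Jones, Computability and Complexity from a Programming
  Perspective). A program is a list of mutually recursive function bodies, its
  entry point being the first one; \<open>EVar i\<close> is the \<open>i\<close>-th argument of the current call.
  The running time is the number of expression nodes evaluated. Trees are passed by
  reference, so for a fixed program each step takes constant time on a random access or
  pointer machine; there is no unit-cost arithmetic and no structural equality test.\<close>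

datatype tree = Leaf | Node tree tree

fun left_of :: "tree \<Rightarrow> tree" where
  "left_of Leaf = Leaf"
| "left_of (Node x y) = x"

fun right_of :: "tree \<Rightarrow> tree" where
  "right_of Leaf = Leaf"
| "right_of (Node x y) = y"

datatype exp =
    EVar nat
  | ELeaf
  | ENode exp exp
  | ELeft exp
  | ERight exp
  | EIf exp exp exp
  | ECall nat "exp list"

type_synonym program = "exp list"

text \<open>\<open>EIf\<close> takes its first branch when the condition evaluates to a \<open>Node\<close>.\<close>

inductive eval :: "program \<Rightarrow> tree list \<Rightarrow> exp \<Rightarrow> tree \<Rightarrow> nat \<Rightarrow> bool"
  and evals :: "program \<Rightarrow> tree list \<Rightarrow> exp list \<Rightarrow> tree list \<Rightarrow> nat \<Rightarrow> bool"
  for P :: program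
where
  eval_EVar: "i < length env \<Longrightarrow> eval P env (EVar i) (env ! i) 1"
| eval_ELeaf: "eval P env ELeaf Leaf 1"
| eval_ENode: "eval P env e1 x s \<Longrightarrow> eval P env e2 y t \<Longrightarrow>
    eval P env (ENode e1 e2) (Node x y) (s + t + 1)"
| eval_ELeft: "eval P env e x s \<Longrightarrow> eval P env (ELeft e) (left_of x) (s + 1)"
| eval_ERight: "eval P env e x s \<Longrightarrow> eval P env (ERight e) (right_of x) (s + 1)"
| eval_EIf_Node: "eval P env c (Node u v) s \<Longrightarrow> eval P env e1 x t \<Longrightarrow>
    eval P env (EIf c e1 e2) x (s + t + 1)"
| eval_EIf_Leaf: "eval P env c Leaf s \<Longrightarrow> eval P env e2 x t \<Longrightarrow>
    eval P env (EIf c e1 e2) x (s + t + 1)"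
| eval_ECall: "f < length P \<Longrightarrow> evals P env es xs s \<Longrightarrow> eval P xs (P ! f) y t \<Longrightarrow>
    eval P env (ECall f es) y (s + t + 1)"
| evals_Nil: "evals P env [] [] 0"
| evals_Cons: "eval P env e x s \<Longrightarrow> evals P env es xs t \<Longrightarrow>
    evals P env (e # es) (x # xs) (s + t)"

inductive_cases eval_EVarE: "eval P env (EVar i) x t"
inductive_cases eval_ELeafE: "eval P env ELeaf x t"
inductive_cases eval_ENodeE: "eval P env (ENode e1 e2) x t"
inductive_cases eval_ELeftE: "eval P env (ELeft e) x t"
inductive_cases eval_ERightE: "eval P env (ERight e) x t"
inductive_cases eval_EIfE: "eval P env (EIf c e1 e2) x t"
inductive_cases eval_ECallE: "eval P env (ECall f es) x t"
inductive_cases evals_NilE: "evals P env [] xs t"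
inductive_cases evals_ConsE: "evals P env (e # es) xs t"

lemma eval_evals_deterministic:
  "eval P env e x t \<Longrightarrow> (\<And>x' t'. eval P env e x' t' \<Longrightarrow> x = x' \<and> t = t')"
  "evals P env es xs s \<Longrightarrow> (\<And>xs' s'. evals P env es xs' s' \<Longrightarrow> xs = xs' \<and> s = s')"
proof (induction rule: eval_evals.inducts)
  case eval_EVar
  from eval_EVar.prems show ?case by (rule eval_EVarE) simp
next
  case eval_ELeaf
  from eval_ELeaf.prems show ?case by (rule eval_ELeafE) simp
next
  case eval_ENode
  from eval_ENode.prems show ?case by (rule eval_ENodeE) (auto dest!: eval_ENode.IH(2,4))
next
  case eval_ELeft
  from eval_ELeft.prems show ?case by (rule eval_ELeftE) (auto dest!: eval_ELeft.IH(2))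
next
  case eval_ERight
  from eval_ERight.prems show ?case by (rule eval_ERightE) (auto dest!: eval_ERight.IH(2))
next
  case eval_EIf_Node
  from eval_EIf_Node.prems show ?case by (rule eval_EIfE) (auto dest!: eval_EIf_Node.IH(2,4))
next
  case eval_EIf_Leaf
  from eval_EIf_Leaf.prems show ?case by (rule eval_EIfE) (auto dest!: eval_EIf_Leaf.IH(2,4))
next
  case eval_ECall
  from eval_ECall.prems show ?case by (rule eval_ECallE) (auto dest!: eval_ECall.IH(3,5))
next
  case evals_Nil
  from evals_Nil.prems show ?case by (rule evals_NilE) simp
next
  case evals_Cons
  from evals_Cons.prems show ?case by (rule evals_ConsE) (auto dest!: evals_Cons.IH(2,4))
qed

definition computes_in :: "program \<Rightarrow> tree \<Rightarrow> tree \<Rightarrow> nat \<Rightarrow> bool" where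
  "computes_in P x y t \<longleftrightarrow> P \<noteq> [] \<and> eval P [x] (P ! 0) y t"


section \<open>Encoding of instances and layouts\<close>

fun enc_nat :: "nat \<Rightarrow> tree" where
  "enc_nat 0 = Leaf"
| "enc_nat (Suc k) = Node Leaf (enc_nat k)"

fun enc_list :: "('a \<Rightarrow> tree) \<Rightarrow> 'a list \<Rightarrow> tree" where
  "enc_list f [] = Leaf"
| "enc_list f (x # xs) = Node (f x) (enc_list f xs)"

definition enc_pair :: "('a \<Rightarrow> tree) \<Rightarrow> ('b \<Rightarrow> tree) \<Rightarrow> 'a \<times> 'b \<Rightarrow> tree" where
  "enc_pair f g p = Node (f (fst p)) (g (snd p))"

definition enc_line :: "line \<Rightarrow> tree" where
  "enc_line = enc_pair enc_nat enc_nat"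

definition enc_instance :: "nat \<Rightarrow> line list \<Rightarrow> tree" where
  "enc_instance n ls = enc_pair enc_nat (enc_list enc_line) (n, ls)"

definition enc_layout :: "nat \<Rightarrow> layout \<Rightarrow> tree" where
  "enc_layout n lay =
     enc_list (enc_pair (enc_list enc_line) (enc_list enc_line)) (map lay [1..<n])"

text \<open>The path with its stations and edges is part of the input (and every layout lists all
  edges), so \<open>n\<close> counts with its value, not with the length of its binary notation.
  This measure is at most the number of nodes of the encoded instance.\<close>

definition input_size :: "nat \<Rightarrow> line set \<Rightarrow> nat" where
  "input_size n L = n + card L"

end

theory Submission
  imports Defs
begin

text \<open>
  Enumerate, for every line, whether it starts above or below the lines passing through its
  first station; there are $2^{|L|}$ choices \<open>x\<close>. Then sweep from left to right. When \<open>l\<close> ends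
  at station \<open>b\<close> it must cross either all lines through \<open>b\<close> above it or all those below it,
  and \<open>x\<close> alone determines these two sets, except for lines that start together with \<open>l\<close> on the
  same side; their order can be chosen so that they never cross \<open>l\<close>. Taking the cheaper side
  for each line separately costs the sum of the minima, and lines ending at the same station do
  not cross each other, because the preference for leaving at the top is monotone in the height.
  Conversely, in a feasible layout with the starting sides \<open>x\<close> every line has to pay at least its
  minimum, since a pair whose order differs between its first and last common edge ends must cross
  in between. So an optimal layout arises from an \<open>x\<close> minimizing that sum.
\<close>

section \<open>Positions in lists\<close>

lemma above_Nil [simp]: "\<not> above [] l m"
  by (simp add: above_def)

text \<open>Replaces the index-based definition by a recursion on the list, on which the inductions
  below rest.\<close>

lemma above_Cons [simp]: "above (x # xs) l m \<longleftrightarrow> l = x \<and> m \<in> set xs \<or> above xs l m"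
proof
  assume "above (x # xs) l m"
  then obtain i j where ij: "i < j" "j < length (x # xs)" "(x # xs) ! i = l" "(x # xs) ! j = m"
    unfolding above_def by blast
  then obtain j' where j': "j = Suc j'" by (cases j) auto
  show "l = x \<and> m \<in> set xs \<or> above xs l m"
  proof (cases i)
    case 0
    then show ?thesis using ij j' by auto
  next
    case (Suc i')
    then show ?thesis using ij j' unfolding above_def by auto
  qed
next
  assume "l = x \<and> m \<in> set xs \<or> above xs l m"
  then show "above (x # xs) l m"
  proof
    assume "l = x \<and> m \<in> set xs"
    then obtain j where "j < length xs" "xs ! j = m" "l = x" by (auto simp: in_set_conv_nth)
    then show ?thesis unfolding above_def by (intro exI[of _ 0] exI[of _ "Suc j"]) auto
  next
    assume "above xs l m"
    then obtain i j where "i < j" "j < length xs" "xs ! i = l" "xs ! j = m"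
      unfolding above_def by blast
    then show ?thesis unfolding above_def by (intro exI[of _ "Suc i"] exI[of _ "Suc j"]) auto
  qed
qed

lemma above_in_set: "above xs l m \<Longrightarrow> l \<in> set xs \<and> m \<in> set xs"
  by (induction xs) auto

lemma above_append [simp]:
  "above (xs @ ys) l m \<longleftrightarrow> above xs l m \<or> above ys l m \<or> l \<in> set xs \<and> m \<in> set ys"
  by (induction xs) auto

lemma above_filter [simp]: "above (filter Q xs) l m \<longleftrightarrow> above xs l m \<and> Q l \<and> Q m"
  by (induction xs) (auto dest: above_in_set)

lemma above_asym: "distinct xs \<Longrightarrow> above xs l m \<Longrightarrow> \<not> above xs m l"
  by (induction xs) (auto dest: above_in_set)

lemma above_trans: "distinct xs \<Longrightarrow> above xs k l \<Longrightarrow> above xs l m \<Longrightarrow> above xs k m"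
  by (induction xs) (auto dest: above_in_set)

lemma above_if_sorted_wrt: "sorted_wrt R xs \<Longrightarrow> above xs l m \<Longrightarrow> R l m"
  by (induction xs) auto

lemma above_total: "l \<in> set xs \<Longrightarrow> m \<in> set xs \<Longrightarrow> l \<noteq> m \<Longrightarrow> above xs l m \<or> above xs m l"
  by (induction xs) auto

section \<open>The order of the lines for given starting sides\<close>

text \<open>\<open>x l\<close> means that \<open>l\<close> starts at the top. Lines starting at the same station on the same
  side are left incomparable.\<close>

definition placed_above :: "(line \<Rightarrow> bool) \<Rightarrow> line \<Rightarrow> line \<Rightarrow> bool" where
  "placed_above x p l \<longleftrightarrow>
     (if fst p < fst l then \<not> x l else if fst l < fst p then x p else x p \<and> \<not> x l)"

text \<open>\<open>y l\<close> means that \<open>l\<close> ends at the top. Lines left incomparable are ordered as they have to be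
  when the shorter one ends.\<close>

definition entry_above :: "(line \<Rightarrow> bool) \<Rightarrow> (line \<Rightarrow> bool) \<Rightarrow> line \<Rightarrow> line \<Rightarrow> bool" where
  "entry_above x y p l \<longleftrightarrow> placed_above x p l \<or>
     \<not> placed_above x l p \<and> (if snd p < snd l then y p else \<not> y l)"

text \<open>\<open>placed_above x\<close> is a strict weak order even on lines without a common
  edge: first the top starters by decreasing first station, then the bottom starters by increasing
  first station.\<close>

lemma placed_above_trans: "placed_above x p q \<Longrightarrow> placed_above x q r \<Longrightarrow> placed_above x p r"
  unfolding placed_above_def by (smt (verit) linorder_less_linear order_less_trans)

text \<open>\<open>entry_above x y p p\<close> amounts to \<open>\<not> y p\<close>, so the order
  laws of \<open>entry_above\<close> are stated for distinct lines.\<close>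

lemma entry_above_total: "p \<noteq> q \<Longrightarrow> entry_above x y p q \<or> entry_above x y q p"
  by (cases p; cases q) (auto simp: entry_above_def placed_above_def split: if_splits)

lemma entry_above_asym: "p \<noteq> q \<Longrightarrow> entry_above x y p q \<Longrightarrow> \<not> entry_above x y q p"
  by (cases p; cases q) (auto simp: entry_above_def placed_above_def split: if_splits)

text \<open>Ties of \<open>placed_above x\<close> are broken linearly: lines leaving at the top come
  first, by increasing last station, then the others by decreasing last station.\<close>

lemma entry_above_trans:
  assumes "entry_above x y p q" "entry_above x y q r" "p \<noteq> q" "q \<noteq> r" "p \<noteq> r"
  shows "entry_above x y p r"
proof -
  have "\<not> (fst p = fst q \<and> snd p = snd q)" "\<not> (fst q = fst r \<and> snd q = snd r)"
    "\<not> (fst p = fst r \<and> snd p = snd r)"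
    using assms by (auto simp: prod_eq_iff)
  then show ?thesis using assms(1,2)
    unfolding entry_above_def placed_above_def by (smt (verit) linorder_less_linear order_less_trans)
qed

text \<open>Ties are left out, so these sets depend on \<open>x\<close> alone and may be used to
  choose the exit sides that later break the ties.\<close>

definition lines_above :: "(line \<Rightarrow> bool) \<Rightarrow> line set \<Rightarrow> line \<Rightarrow> line set" where
  "lines_above x L l = {p \<in> L. passes_through p (snd l) \<and> placed_above x p l}"

definition lines_below :: "(line \<Rightarrow> bool) \<Rightarrow> line set \<Rightarrow> line \<Rightarrow> line set" where
  "lines_below x L l = {p \<in> L. passes_through p (snd l) \<and> placed_above x l p}"

definition exits_top :: "(line \<Rightarrow> bool) \<Rightarrow> line set \<Rightarrow> line \<Rightarrow> bool" where
  "exits_top x L l \<longleftrightarrow> card (lines_above x L l) \<le> card (lines_below x L l)"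

definition exit_cost :: "(line \<Rightarrow> bool) \<Rightarrow> line set \<Rightarrow> nat" where
  "exit_cost x L = (\<Sum>l\<in>L. min (card (lines_above x L l)) (card (lines_below x L l)))"

text \<open>This is why lines with a common last station need not cross when they leave.\<close>

lemma exits_top_mono:
  assumes "finite L" "snd l = snd m" "placed_above x m l" "exits_top x L l"
  shows "exits_top x L m"
proof -
  have "card (lines_above x L m) \<le> card (lines_above x L l)"
    using assms by (intro card_mono) (auto simp: lines_above_def intro: placed_above_trans)
  moreover have "card (lines_below x L l) \<le> card (lines_below x L m)"
    using assms by (intro card_mono) (auto simp: lines_below_def intro: placed_above_trans)
  ultimately show ?thesis using assms(4) unfolding exits_top_def by linarith
qed

section \<open>The greedy layout and its optimality\<close>

text \<open>Phrased with strict comparisons because the program compares numbers only by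
  \<open>f_less\<close>.\<close>

definition on_edge :: "nat \<Rightarrow> line \<Rightarrow> bool" where
  "on_edge i l \<longleftrightarrow> \<not> i < fst l \<and> i < snd l"

text \<open>All edges share the single order \<open>S\<close>; a line departs from it only on its
  last edge, moving to the block of its exit side.\<close>

definition sweep_layout :: "(line \<Rightarrow> bool) \<Rightarrow> line list \<Rightarrow> layout" where
  "sweep_layout y S i =
     (filter (on_edge i) S,
      filter (\<lambda>l. on_edge i l \<and> \<not> Suc i < snd l \<and> y l) S @
      filter (\<lambda>l. \<not> i < fst l \<and> Suc i < snd l) S @
      filter (\<lambda>l. on_edge i l \<and> \<not> Suc i < snd l \<and> \<not> y l) S)"

lemma sweep_layout_feasible:
  assumes L: "mlcm_instance n L"
    and S: "distinct S" "set S = L" "sorted_wrt (entry_above x y) S"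
  shows "mlcm_p_feasible n L (sweep_layout y S)"
proof -
  have "is_layout n L (sweep_layout y S)"
    using S unfolding is_layout_def left_end_def right_end_def sweep_layout_def lines_on_def
    by (auto simp: on_edge_def)
  \<comment> \<open>Restricted to the lines through a station, the orders on its two sides are
    filters of the same list \<open>S\<close>.\<close>
  moreover have "admissible n L (sweep_layout y S)"
    unfolding admissible_def left_end_def right_end_def sweep_layout_def
    by (auto simp: on_edge_def passes_through_def)
  moreover have "extremal (left_end (sweep_layout y S) a) (a, b) {m \<in> L. passes_through m a}"
    "extremal (right_end (sweep_layout y S) (b - 1)) (a, b) {m \<in> L. passes_through m b}"
    if l: "(a, b) \<in> L" for a b
  proof -
    have ab: "1 \<le> a" "a < b" using L l by (auto simp: mlcm_instance_def)
    have E: "above S l m \<longleftrightarrow> entry_above x y l m" if "l \<in> L" "m \<in> L" "l \<noteq> m" for l m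
      using above_if_sorted_wrt[OF S(3)] above_total[of l S m] entry_above_asym[of l m x y] that S(2)
      by blast
    \<comment> \<open>A line through \<open>a\<close> starts before \<open>a\<close>, and in
      \<open>placed_above\<close> the side of the later starter decides.\<close>
    have *: "above S (a, b) m \<longleftrightarrow> x (a, b)" "above S m (a, b) \<longleftrightarrow> \<not> x (a, b)"
      if m: "m \<in> L" "passes_through m a" for m
    proof -
      have "m \<noteq> (a, b)" using m by (auto simp: passes_through_def)
      then show "above S (a, b) m \<longleftrightarrow> x (a, b)" "above S m (a, b) \<longleftrightarrow> \<not> x (a, b)"
        using m l by (auto simp: E entry_above_def placed_above_def passes_through_def)
    qed
    have "on_edge a m" if "passes_through m a" for m
      using that by (auto simp: on_edge_def passes_through_def)
    with * ab show "extremal (left_end (sweep_layout y S) a) (a, b) {m \<in> L. passes_through m a}"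
      unfolding extremal_def left_end_def sweep_layout_def
      by (cases "x (a, b)") (auto simp: on_edge_def)
    show "extremal (right_end (sweep_layout y S) (b - 1)) (a, b) {m \<in> L. passes_through m b}"
      using ab l unfolding extremal_def right_end_def sweep_layout_def
      by (cases "y (a, b)") (auto simp: on_edge_def passes_through_def S(2))
  qed
  ultimately show ?thesis
    unfolding mlcm_p_feasible_def periphery_condition_def by auto
qed

text \<open>Each crossing is charged to a line ending at the right end of its edge; the other line
  then lies in the smaller of the two sets, \<open>C l\<close>.\<close>

lemma sweep_layout_crossing_number:
  assumes L: "finite L"
    and S: "distinct S" "set S = L" "sorted_wrt (entry_above x (exits_top x L)) S"
  shows "crossing_number n L (sweep_layout (exits_top x L) S) \<le> exit_cost x L"
proof -
  define y where "y = exits_top x L"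
  define C where "C l = (if y l then lines_above x L l else lines_below x L l)" for l
  have fin: "finite (C l)" for l
    using L by (auto simp: C_def lines_above_def lines_below_def)
  have E: "above S l m \<longleftrightarrow> entry_above x y l m" if "l \<in> L" "m \<in> L" "l \<noteq> m" for l m
    using above_if_sorted_wrt[OF S(3)] above_total[of l S m] entry_above_asym[of l m x y] that S(2)
    unfolding y_def by blast
  have key: "snd l = Suc i \<and> m \<in> C l \<or> snd m = Suc i \<and> l \<in> C m"
    if lm: "l \<in> lines_on L i" "m \<in> lines_on L i" "l \<noteq> m" "cross (sweep_layout y S) i l m"
    for i l m
  proof -
    have L': "l \<in> L" "m \<in> L" and on: "on_edge i l" "on_edge i m"
      using lm by (auto simp: lines_on_def on_edge_def)
    \<comment> \<open>A tie is impossible here: \<open>entry_above\<close> puts the shorter of two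
      tied lines on its exit side already.\<close>
    have *: "m' \<in> C l'" if "snd l' = Suc i" "Suc i < snd m'" "fst m' \<le> i" "m' \<in> L"
      "entry_above x y l' m' \<longleftrightarrow> \<not> y l'" for l' m'
      using that by (auto simp: C_def lines_above_def lines_below_def passes_through_def
          entry_above_def split: if_splits)
    \<comment> \<open>Distinct lines with the same last station have different first stations, so
      \<open>placed_above\<close> decides and \<open>exits_top_mono\<close> applies.\<close>
    have mono: "y m'" if "snd l' = Suc i" "snd m' = Suc i" "l' \<noteq> m'" "y l'" "entry_above x y m' l'"
      for l' m'
    proof -
      have "fst l' \<noteq> fst m'" using that by (auto simp: prod_eq_iff)
      then have "placed_above x m' l'" using that(5)
        by (auto simp: entry_above_def placed_above_def split: if_splits)
      then show ?thesis using exits_top_mono[OF L, of l' m' x] that by (simp add: y_def)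
    qed
    have X: "entry_above x y l m \<noteq> above (right_end (sweep_layout y S) i) l m"
      using lm(4) on L' lm(3) by (simp add: cross_def left_end_def sweep_layout_def E)
    have flip: "entry_above x y m l \<longleftrightarrow> \<not> entry_above x y l m"
      using entry_above_asym entry_above_total lm(3) by metis
    consider "snd l = Suc i" "snd m = Suc i" | "snd l = Suc i" "Suc i < snd m"
      | "Suc i < snd l" "snd m = Suc i" | "Suc i < snd l" "Suc i < snd m"
      using on unfolding on_edge_def by linarith
    then show ?thesis
    proof cases
      \<comment> \<open>Two lines ending together do not cross, by \<open>mono\<close>, so this case
        is contradictory.\<close>
      case 1
      then show ?thesis using X on L' lm(3) S(2) flip mono[of l m] mono[of m l]
        by (auto simp: right_end_def sweep_layout_def E)
    next
      case 2
      then have "above (right_end (sweep_layout y S) i) l m \<longleftrightarrow> y l"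
        using on L' lm(3) S(2) by (auto simp: right_end_def sweep_layout_def on_edge_def)
      then show ?thesis using *[of l m] 2 X on L' by (auto simp: on_edge_def)
    next
      case 3
      then have "above (right_end (sweep_layout y S) i) l m \<longleftrightarrow> \<not> y m"
        using on L' lm(3) S(2) by (auto simp: right_end_def sweep_layout_def on_edge_def)
      then show ?thesis using *[of m l] 3 X on L' flip by (auto simp: on_edge_def)
    next
      case 4
      then show ?thesis using X on L' lm(3)
        by (auto simp: right_end_def sweep_layout_def on_edge_def E)
    qed
  qed
  have "{({l, m}, i) | l m i. i \<in> edges n \<and> l \<in> lines_on L i \<and> m \<in> lines_on L i \<and> l \<noteq> m \<and>
          cross (sweep_layout y S) i l m} \<subseteq> (\<lambda>(l, m). ({l, m}, snd l - 1)) ` (SIGMA l:L. C l)"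
    (is "?X \<subseteq> ?f ` _")
  proof
    fix z assume "z \<in> ?X"
    then obtain l m i where z: "z = ({l, m}, i)" "l \<in> lines_on L i" "m \<in> lines_on L i" "l \<noteq> m"
      "cross (sweep_layout y S) i l m" by blast
    then have "l \<in> L" "m \<in> L" by (auto simp: lines_on_def)
    from key[OF z(2-5)] show "z \<in> ?f ` (SIGMA l:L. C l)"
    proof
      assume "snd l = Suc i \<and> m \<in> C l"
      then show ?thesis using z \<open>l \<in> L\<close> by (intro image_eqI[of _ _ "(l, m)"]) auto
    next
      assume "snd m = Suc i \<and> l \<in> C m"
      then show ?thesis using z \<open>m \<in> L\<close> by (intro image_eqI[of _ _ "(m, l)"]) auto
    qed
  qed
  then have "crossing_number n L (sweep_layout y S) \<le> card (SIGMA l:L. C l)"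
    unfolding crossing_number_def using L fin by (intro surj_card_le) auto
  also have "\<dots> = (\<Sum>l\<in>L. card (C l))"
    using L fin by (intro card_SigmaI) auto
  also have "\<dots> = exit_cost x L"
    unfolding exit_cost_def by (rule sum.cong) (auto simp: C_def y_def exits_top_def)
  finally show ?thesis by (simp add: y_def)
qed

section \<open>Lower bound for every feasible layout\<close>

lemma order_change_imp_cross:
  assumes adm: "admissible n L lay" and lm: "l \<in> L" "m \<in> L" "fst l \<le> s" "fst m \<le> s"
    and s: "1 \<le> s" and j: "s \<le> j" "j < snd l" "j < snd m" "snd l \<le> n"
    and "above (left_end lay s) l m \<noteq> above (right_end lay j) l m"
  shows "\<exists>i. s \<le> i \<and> i \<le> j \<and> cross lay i l m"
proof (rule ccontr)
  assume no: "\<nexists>i. s \<le> i \<and> i \<le> j \<and> cross lay i l m"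
  \<comment> \<open>Both lines pass through every station in between, where admissibility carries
    the order over; it can change only along an edge.\<close>
  have "above (left_end lay s) l m = above (right_end lay k) l m" if "s \<le> k" "k \<le> j" for k
    using that
  proof (induction k rule: dec_induct)
    case base
    then show ?case using no by (auto simp: cross_def)
  next
    case (step k)
    have "passes_through l (Suc k)" "passes_through m (Suc k)"
      using step lm j by (auto simp: passes_through_def)
    moreover have "1 < Suc k" "Suc k < n"
      using step j s by auto
    ultimately have "above (right_end lay k) l m = above (left_end lay (Suc k)) l m"
      using adm lm(1,2) unfolding admissible_def by fastforce
    moreover have "above (left_end lay (Suc k)) l m = above (right_end lay (Suc k)) l m"
      using no step by (auto simp: cross_def)
    ultimately show ?case using step by simp
  qed
  then show False using assms by simp
qed

text \<open>The sides \<open>x\<close> and \<open>y\<close> are read off the layout. For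
  \<open>m \<in> C l\<close> the starting order disagrees with the exit side of \<open>l\<close>,
  which forces a crossing; different pairs force different crossings.\<close>

lemma exit_cost_lower_bound:
  assumes L: "mlcm_instance n L" and lay: "mlcm_p_feasible n L lay"
  shows "\<exists>x. exit_cost x L \<le> crossing_number n L lay"
proof -
  \<comment> \<open>If nothing passes through the first station of \<open>l\<close>, then \<open>x l\<close> holds vacuously; hence lines with
    different sides at a common first station are separated by a passing line.\<close>
  define x where "x l \<longleftrightarrow> (\<forall>m \<in> L. passes_through m (fst l) \<longrightarrow> above (left_end lay (fst l)) l m)" for l
  define y where "y l \<longleftrightarrow> (\<forall>m \<in> L. passes_through m (snd l) \<longrightarrow> above (right_end lay (snd l - 1)) l m)" for l
  define C where "C l = (if y l then lines_above x L l else lines_below x L l)" for l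
  have fin: "finite L" using L by (simp add: mlcm_instance_def)
  have rng: "1 \<le> fst l" "fst l < snd l" "snd l \<le> n" if "l \<in> L" for l
    using L that by (auto simp: mlcm_instance_def)
  have dist: "distinct (left_end lay i)" "distinct (right_end lay i)" if "1 \<le> i" "i < n" for i
    using lay that by (auto simp: mlcm_p_feasible_def is_layout_def edges_def)
  have adm: "admissible n L lay" using lay by (simp add: mlcm_p_feasible_def)
  have nx: "above (left_end lay (fst l)) m l"
    if "l \<in> L" "\<not> x l" "m \<in> L" "passes_through m (fst l)" for l m
    using lay that unfolding mlcm_p_feasible_def periphery_condition_def extremal_def x_def by fastforce
  have ny: "above (right_end lay (snd l - 1)) m l"
    if "l \<in> L" "\<not> y l" "m \<in> L" "passes_through m (snd l)" for l m
    using lay that unfolding mlcm_p_feasible_def periphery_condition_def extremal_def y_def by fastforce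
  have entry: "above (left_end lay (max (fst p) (fst l))) p l"
    if pl: "p \<in> L" "l \<in> L" "placed_above x p l" "fst p < snd l" "fst l < snd p" for p l
  proof -
    consider "fst p < fst l" "\<not> x l" | "fst l < fst p" "x p" | "fst p = fst l" "x p" "\<not> x l"
      using pl(3) unfolding placed_above_def by (metis linorder_less_linear)
    then show ?thesis
    proof cases
      case 1
      then show ?thesis using nx[of l p] pl by (auto simp: passes_through_def max_def)
    next
      case 2
      then show ?thesis using pl unfolding x_def by (auto simp: passes_through_def max_def)
    next
      case 3
      \<comment> \<open>As \<open>x l\<close> fails, it is not vacuously true: some \<open>q\<close>
        passes through the common first station and separates \<open>p\<close> from
        \<open>l\<close>.\<close>
      then obtain q where q: "q \<in> L" "passes_through q (fst l)" by (auto simp: x_def)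
      then have "above (left_end lay (fst l)) p q" "above (left_end lay (fst l)) q l"
        using 3 nx[of l q] pl unfolding x_def by auto
      then show ?thesis using 3 above_trans dist(1)[of "fst l"] rng[OF pl(2)] by auto
    qed
  qed
  have "\<exists>i. i \<in> edges n \<and> l \<in> lines_on L i \<and> m \<in> lines_on L i \<and> cross lay i l m"
    if lm: "l \<in> L" "m \<in> C l" for l m
  proof -
    have m: "m \<in> L" "fst m < snd l" "snd l < snd m"
      using lm by (auto simp: C_def lines_above_def lines_below_def passes_through_def split: if_splits)
    define s where "s = max (fst l) (fst m)"
    have s: "1 \<le> s" "s \<le> snd l - 1" "s < n" "snd l - 1 < n" "1 \<le> snd l - 1"
      using rng[OF lm(1)] m by (auto simp: s_def)
    have p: "passes_through m (snd l)" using m by (simp add: passes_through_def)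
    have "above (left_end lay s) l m \<noteq> above (right_end lay (snd l - 1)) l m"
    proof (cases "y l")
      case True
      then have "above (left_end lay s) m l"
        using entry[of m l] lm m rng[OF lm(1)]
        by (auto simp: C_def lines_above_def s_def max.commute)
      then show ?thesis using True above_asym dist(1) s p m unfolding y_def by blast
    next
      case False
      then have "above (left_end lay s) l m"
        using entry[of l m] lm m rng[OF lm(1)] by (auto simp: C_def lines_below_def s_def)
      then show ?thesis using ny[OF lm(1) False m(1) p] above_asym dist(2) s by blast
    qed
    moreover have "fst l \<le> s" "fst m \<le> s" "snd l - 1 < snd l" "snd l - 1 < snd m"
      using m rng[OF lm(1)] by (auto simp: s_def)
    ultimately obtain i where i: "s \<le> i" "i \<le> snd l - 1" "cross lay i l m"
      using order_change_imp_cross[OF adm lm(1) m(1)] rng[OF lm(1)] s by blast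
    then have "i \<in> edges n" "l \<in> lines_on L i" "m \<in> lines_on L i"
      using s m lm(1) rng[OF lm(1)] by (auto simp: edges_def lines_on_def s_def split: prod.splits)
    with i(3) show ?thesis by blast
  qed
  then obtain g where g: "\<And>l m. l \<in> L \<Longrightarrow> m \<in> C l \<Longrightarrow>
      g l m \<in> edges n \<and> l \<in> lines_on L (g l m) \<and> m \<in> lines_on L (g l m) \<and> cross lay (g l m) l m"
    by metis
  \<comment> \<open>The partner always ends later, so the unordered pair determines which line is
    charged; hence the injectivity below.\<close>
  have C: "m \<in> C l \<Longrightarrow> snd l < snd m" for l m
    by (auto simp: C_def lines_above_def lines_below_def passes_through_def split: if_splits)
  let ?X = "{({l, m}, i) | l m i. i \<in> edges n \<and> l \<in> lines_on L i \<and> m \<in> lines_on L i \<and> l \<noteq> m \<and>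
          cross lay i l m}"
  let ?f = "\<lambda>(l, m). ({l, m}, g l m)"
  have "finite ?X"
  proof (rule finite_subset)
    show "?X \<subseteq> Pow L \<times> edges n" by (auto simp: lines_on_def)
  qed (use fin in \<open>auto simp: edges_def\<close>)
  moreover have "?f ` (SIGMA l:L. C l) \<subseteq> ?X"
  proof
    fix z assume "z \<in> ?f ` (SIGMA l:L. C l)"
    then obtain l m where "z = ({l, m}, g l m)" "l \<in> L" "m \<in> C l" by auto
    then show "z \<in> ?X" using g[of l m] C[of m l] by blast
  qed
  moreover have "inj_on ?f (SIGMA l:L. C l)"
  proof (rule inj_onI)
    fix u v assume uv: "u \<in> (SIGMA l:L. C l)" "v \<in> (SIGMA l:L. C l)" "?f u = ?f v"
    obtain l m l' m' where eq: "u = (l, m)" "v = (l', m')" by (cases u; cases v)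
    then have "{l, m} = {l', m'}" "snd l < snd m" "snd l' < snd m'" using uv C by auto
    then show "u = v" unfolding eq by (auto simp: doubleton_eq_iff)
  qed
  ultimately have "card (SIGMA l:L. C l) \<le> crossing_number n L lay"
    unfolding crossing_number_def by (metis (no_types, lifting) card_inj_on_le)
  moreover have "card (SIGMA l:L. C l) = (\<Sum>l\<in>L. card (C l))"
    using fin by (intro card_SigmaI) (auto simp: C_def lines_above_def lines_below_def)
  moreover have "exit_cost x L \<le> (\<Sum>l\<in>L. card (C l))"
    unfolding exit_cost_def by (rule sum_mono) (auto simp: C_def)
  ultimately show ?thesis by (intro exI[of _ x]) linarith
qed

lemma sweep_layout_optimal:
  assumes L: "mlcm_instance n L"
    and S: "distinct S" "set S = L" "sorted_wrt (entry_above x (exits_top x L)) S"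
    and min: "\<And>x'. exit_cost x L \<le> exit_cost x' L"
  shows "mlcm_p_optimal n L (sweep_layout (exits_top x L) S)"
proof -
  have fin: "finite L" using L by (simp add: mlcm_instance_def)
  have "crossing_number n L (sweep_layout (exits_top x L) S) \<le> crossing_number n L lay"
    if "mlcm_p_feasible n L lay" for lay
    using sweep_layout_crossing_number[OF fin S] exit_cost_lower_bound[OF L that] min
    by (meson le_trans)
  then show ?thesis using sweep_layout_feasible[OF L S]
    unfolding mlcm_p_optimal_def is_arg_min_linorder by blast
qed

section \<open>Weakest preconditions for programs\<close>

inductive_simps eval_iffs:
  "eval P env (EVar i) x t" "eval P env ELeaf x t" "eval P env (ENode e1 e2) x t"
  "eval P env (ELeft e) x t" "eval P env (ERight e) x t" "eval P env (EIf c e1 e2) x t"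
  "eval P env (ECall f es) x t"

inductive_simps evals_iffs:
  "evals P env [] xs t" "evals P env (e # es) xs t"

text \<open>Total correctness with the running time in the postcondition; evaluation is
  deterministic, so an existential is enough.\<close>

definition wp :: "program \<Rightarrow> tree list \<Rightarrow> exp \<Rightarrow> (tree \<Rightarrow> nat \<Rightarrow> bool) \<Rightarrow> bool" where
  "wp P env e Q \<longleftrightarrow> (\<exists>y t. eval P env e y t \<and> Q y t)"

definition wps :: "program \<Rightarrow> tree list \<Rightarrow> exp list \<Rightarrow> (tree list \<Rightarrow> nat \<Rightarrow> bool) \<Rightarrow> bool" where
  "wps P env es Q \<longleftrightarrow> (\<exists>ys t. evals P env es ys t \<and> Q ys t)"

text \<open>Kept folded, so that simplifying a body stops at its calls, whose specifications enter
  through \<open>wp_callI\<close>.\<close>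

definition wp_call :: "program \<Rightarrow> nat \<Rightarrow> tree list \<Rightarrow> (tree \<Rightarrow> nat \<Rightarrow> bool) \<Rightarrow> bool" where
  "wp_call P f xs Q \<longleftrightarrow> f < length P \<and> wp P xs (P ! f) Q"

definition runs :: "program \<Rightarrow> nat \<Rightarrow> tree list \<Rightarrow> tree \<Rightarrow> nat \<Rightarrow> bool" where
  "runs P f xs y T \<longleftrightarrow> wp_call P f xs (\<lambda>y' t. y' = y \<and> t \<le> T)"

lemma wp_simps [simp]:
  "wp P env (EVar i) Q \<longleftrightarrow> i < length env \<and> Q (env ! i) 1"
  "wp P env ELeaf Q \<longleftrightarrow> Q Leaf 1"
  "wp P env (ENode a b) Q \<longleftrightarrow> wp P env a (\<lambda>x s. wp P env b (\<lambda>y t. Q (Node x y) (s + t + 1)))"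
  "wp P env (ELeft e) Q \<longleftrightarrow> wp P env e (\<lambda>x s. Q (left_of x) (s + 1))"
  "wp P env (ERight e) Q \<longleftrightarrow> wp P env e (\<lambda>x s. Q (right_of x) (s + 1))"
  "wp P env (ECall f es) Q \<longleftrightarrow> wps P env es (\<lambda>xs s. wp_call P f xs (\<lambda>y t. Q y (s + t + 1)))"
  "wps P env [] R \<longleftrightarrow> R [] 0"
  "wps P env (e # es) R \<longleftrightarrow> wp P env e (\<lambda>x s. wps P env es (\<lambda>xs t. R (x # xs) (s + t)))"
  unfolding wp_def wps_def wp_call_def eval_iffs evals_iffs by auto blast+

lemma wp_EIf [simp]:
  "wp P env (EIf c a b) Q \<longleftrightarrow>
     wp P env c (\<lambda>x s. if x = Leaf then wp P env b (\<lambda>y t. Q y (s + t + 1))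
                       else wp P env a (\<lambda>y t. Q y (s + t + 1)))"
proof
  assume "wp P env (EIf c a b) Q"
  then obtain y t where "eval P env (EIf c a b) y t" "Q y t" unfolding wp_def by blast
  then show "wp P env c (\<lambda>x s. if x = Leaf then wp P env b (\<lambda>y t. Q y (s + t + 1))
                       else wp P env a (\<lambda>y t. Q y (s + t + 1)))"
  proof (elim eval_EIfE)
    fix u v s t' assume "t = Suc (s + t')" "eval P env c (Node u v) s" "eval P env a y t'" "Q y t"
    then show ?thesis unfolding wp_def by (intro exI[of _ "Node u v"] exI[of _ s]) auto
  next
    fix s t' assume "t = Suc (s + t')" "eval P env c Leaf s" "eval P env b y t'" "Q y t"
    then show ?thesis unfolding wp_def by (intro exI[of _ Leaf] exI[of _ s]) auto
  qed
next
  assume "wp P env c (\<lambda>x s. if x = Leaf then wp P env b (\<lambda>y t. Q y (s + t + 1))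
                       else wp P env a (\<lambda>y t. Q y (s + t + 1)))"
  then obtain x s where x: "eval P env c x s"
    "if x = Leaf then wp P env b (\<lambda>y t. Q y (s + t + 1)) else wp P env a (\<lambda>y t. Q y (s + t + 1))"
    unfolding wp_def by blast
  show "wp P env (EIf c a b) Q"
  proof (cases x)
    case Leaf
    then have "wp P env b (\<lambda>y t. Q y (s + t + 1))" using x by simp
    then show ?thesis using x(1) Leaf eval_EIf_Leaf unfolding wp_def by blast
  next
    case (Node u v)
    then have "wp P env a (\<lambda>y t. Q y (s + t + 1))" using x by simp
    then show ?thesis using x(1) Node eval_EIf_Node unfolding wp_def by blast
  qed
qed

lemma wp_mono: "wp P env e Q \<Longrightarrow> (\<And>y t. Q y t \<Longrightarrow> Q' y t) \<Longrightarrow> wp P env e Q'"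
  unfolding wp_def by blast

lemma wp_callI: "runs P f xs y T \<Longrightarrow> (\<And>t. t \<le> T \<Longrightarrow> Q y t) \<Longrightarrow> wp_call P f xs Q"
  unfolding runs_def wp_call_def by (blast intro: wp_mono)

lemma runs_mono: "runs P f xs y T \<Longrightarrow> T \<le> T' \<Longrightarrow> runs P f xs y T'"
  unfolding runs_def wp_call_def by (force intro: wp_mono)

section \<open>The program\<close>

definition enc_bool :: "bool \<Rightarrow> tree" where
  "enc_bool b = (if b then Node Leaf Leaf else Leaf)"

lemma enc_bool_simps [simp]:
  "enc_bool b = Leaf \<longleftrightarrow> \<not> b" "Leaf = enc_bool b \<longleftrightarrow> \<not> b"
  "Node Leaf Leaf = enc_bool b \<longleftrightarrow> b"
  "enc_bool b = enc_bool c \<longleftrightarrow> b = c"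
  by (auto simp: enc_bool_def)

lemma enc_nat_eq_Leaf [simp]: "enc_nat m = Leaf \<longleftrightarrow> m = 0"
  by (cases m) auto

lemma right_of_enc_nat [simp]: "right_of (enc_nat m) = enc_nat (m - 1)"
  by (cases m) auto

text \<open>Folds successors into \<open>enc_nat\<close>; the defining equation, which would undo
  this, leaves the simp set.\<close>

lemma Node_enc_nat [simp]: "Node Leaf (enc_nat m) = enc_nat (Suc m)"
  by simp

declare enc_nat.simps(2) [simp del]

text \<open>A unary number is a list of leaves, so a filter that emits \<open>Leaf\<close>
  counts.\<close>

lemma enc_list_Leaf: "enc_list (\<lambda>_. Leaf) xs = enc_nat (length xs)"
  by (induction xs) auto

text \<open>The language has no functions as values, so each line carries its own side.\<close>

definition enc1 :: "(line \<Rightarrow> bool) \<Rightarrow> line \<Rightarrow> tree" where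
  "enc1 x l = Node (enc_bool (x l)) (enc_line l)"

definition enc2 :: "(line \<Rightarrow> bool) \<Rightarrow> (line \<Rightarrow> bool) \<Rightarrow> line \<Rightarrow> tree" where
  "enc2 x y l = Node (enc_bool (y l)) (enc1 x l)"

lemma enc_sel [simp]:
  "left_of (enc_line l) = enc_nat (fst l)" "right_of (enc_line l) = enc_nat (snd l)"
  "left_of (enc1 x l) = enc_bool (x l)" "right_of (enc1 x l) = enc_line l"
  "left_of (enc2 x y l) = enc_bool (y l)" "right_of (enc2 x y l) = enc1 x l"
  by (auto simp: enc_line_def enc_pair_def enc1_def enc2_def)

abbreviation ETrue :: exp where "ETrue \<equiv> ENode ELeaf ELeaf"
abbreviation ENot :: "exp \<Rightarrow> exp" where "ENot e \<equiv> EIf e ELeaf ETrue"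
abbreviation EAnd :: "exp \<Rightarrow> exp \<Rightarrow> exp" where "EAnd e e' \<equiv> EIf e e' ELeaf"

text \<open>Positions in \<open>solver\<close>; 1 appears as \<open>Suc 0\<close>, its simp normal
  form.\<close>

abbreviation (input) "f_less \<equiv> Suc 0"
abbreviation (input) "f_placed \<equiv> 2 :: nat"
abbreviation (input) "f_above \<equiv> 3 :: nat"
abbreviation (input) "f_below \<equiv> 4 :: nat"
abbreviation (input) "f_min \<equiv> 5 :: nat"
abbreviation (input) "f_add \<equiv> 6 :: nat"
abbreviation (input) "f_cost \<equiv> 7 :: nat"
abbreviation (input) "f_better \<equiv> 8 :: nat"
abbreviation (input) "f_search \<equiv> 9 :: nat"
abbreviation (input) "f_exits \<equiv> 10 :: nat"
abbreviation (input) "f_entry \<equiv> 11 :: nat"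
abbreviation (input) "f_insert \<equiv> 12 :: nat"
abbreviation (input) "f_sort \<equiv> 13 :: nat"
abbreviation (input) "f_left \<equiv> 14 :: nat"
abbreviation (input) "f_top \<equiv> 15 :: nat"
abbreviation (input) "f_middle \<equiv> 16 :: nat"
abbreviation (input) "f_bottom \<equiv> 17 :: nat"
abbreviation (input) "f_edges \<equiv> 18 :: nat"
abbreviation (input) "f_output \<equiv> 19 :: nat"

abbreviation "ELess e e' \<equiv> ECall f_less [e, e']"

abbreviation start1 :: "exp \<Rightarrow> exp" where "start1 e \<equiv> ELeft (ERight e)"
abbreviation stop1 :: "exp \<Rightarrow> exp" where "stop1 e \<equiv> ERight (ERight e)"

text \<open>On arguments \<open>[S, c, acc]\<close> this prepends to \<open>acc\<close> the values of \<open>emit\<close> on those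
  elements of the list \<open>S\<close> that pass \<open>test\<close>; both expressions refer to the current
  element as \<open>item\<close>.\<close>

abbreviation item :: exp where "item \<equiv> ELeft (EVar 0)"

definition filter_body :: "nat \<Rightarrow> exp \<Rightarrow> exp \<Rightarrow> exp" where
  "filter_body f test emit =
     EIf (EVar 0)
       (EIf test
         (ENode emit (ECall f [ERight (EVar 0), EVar 1, EVar 2]))
         (ECall f [ERight (EVar 0), EVar 1, EVar 2]))
       (EVar 2)"

abbreviation through_test :: "exp \<Rightarrow> exp" where
  "through_test e \<equiv> EAnd (ELess (start1 item) (stop1 (EVar 1)))
     (EAnd (ELess (stop1 (EVar 1)) (stop1 item)) e)"

abbreviation starts_after :: exp where
  "starts_after \<equiv> ELess (EVar 1) (start1 (ERight item))"

abbreviation continues :: exp where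
  "continues \<equiv> ELess (ENode ELeaf (EVar 1)) (stop1 (ERight item))"

abbreviation on_test :: exp where
  "on_test \<equiv> EAnd (ENot starts_after) (ELess (EVar 1) (stop1 (ERight item)))"

section \<open>Function bodies of the solver\<close>

definition body_main :: exp where
  "body_main =
     ECall f_output [ELeft (EVar 0), ECall f_search [ERight (EVar 0), ELeaf]]"

definition body_less :: exp where
  "body_less =
     EIf (EVar 1) (EIf (EVar 0) (ELess (ERight (EVar 0)) (ERight (EVar 1))) ETrue) ELeaf"

definition body_placed :: exp where
  "body_placed =
     EIf (ELess (start1 (EVar 0)) (start1 (EVar 1))) (ENot (ELeft (EVar 1)))
       (EIf (ELess (start1 (EVar 1)) (start1 (EVar 0))) (ELeft (EVar 0))
         (EAnd (ELeft (EVar 0)) (ENot (ELeft (EVar 1)))))"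

definition body_above :: exp where
  "body_above =
     filter_body f_above (through_test (ECall f_placed [item, EVar 1])) ELeaf"

definition body_below :: exp where
  "body_below =
     filter_body f_below (through_test (ECall f_placed [EVar 1, item])) ELeaf"

definition body_min :: exp where
  "body_min =
     EIf (ELess (EVar 0) (EVar 1)) (EVar 0) (EVar 1)"

definition body_add :: exp where
  "body_add =
     EIf (EVar 0) (ENode ELeaf (ECall f_add [ERight (EVar 0), EVar 1])) (EVar 1)"

definition body_cost :: exp where
  "body_cost =
     EIf (EVar 0)
       (ECall f_add
         [ECall f_min [ECall f_above [EVar 1, item, ELeaf], ECall f_below [EVar 1, item, ELeaf]],
          ECall f_cost [ERight (EVar 0), EVar 1]])
       ELeaf"

text \<open>Costs are recomputed at every inner node of the search instead of being passed upwards;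
  this is only a polynomial factor.\<close>

definition body_better :: exp where
  "body_better =
     EIf (ELess (ECall f_cost [EVar 1, EVar 1]) (ECall f_cost [EVar 0, EVar 0])) (EVar 1) (EVar 0)"

definition body_search :: exp where
  "body_search =
     EIf (EVar 0)
       (ECall f_better
         [ECall f_search [ERight (EVar 0), ENode (ENode ETrue item) (EVar 1)],
          ECall f_search [ERight (EVar 0), ENode (ENode ELeaf item) (EVar 1)]])
       (EVar 1)"

text \<open>With the test \<open>ETrue\<close> the filter loop becomes a map.\<close>

definition body_exits :: exp where
  "body_exits =
     filter_body f_exits ETrue
       (ENode (ENot (ELess (ECall f_below [EVar 1, item, ELeaf])
                           (ECall f_above [EVar 1, item, ELeaf]))) item)"

definition body_entry :: exp where
  "body_entry =
     EIf (ECall f_placed [ERight (EVar 0), ERight (EVar 1)]) ETrue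
       (EIf (ECall f_placed [ERight (EVar 1), ERight (EVar 0)]) ELeaf
         (EIf (ELess (stop1 (ERight (EVar 0))) (stop1 (ERight (EVar 1))))
           (ELeft (EVar 0)) (ENot (ELeft (EVar 1)))))"

definition body_insert :: exp where
  "body_insert =
     EIf (EVar 1)
       (EIf (ECall f_entry [ELeft (EVar 1), EVar 0])
         (ENode (ELeft (EVar 1)) (ECall f_insert [EVar 0, ERight (EVar 1)]))
         (ENode (EVar 0) (EVar 1)))
       (ENode (EVar 0) ELeaf)"

definition body_sort :: exp where
  "body_sort =
     EIf (EVar 0) (ECall f_insert [item, ECall f_sort [ERight (EVar 0)]]) ELeaf"

definition body_left :: exp where
  "body_left =
     filter_body f_left on_test (ERight (ERight item))"

definition body_top :: exp where
  "body_top =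
     filter_body f_top (EAnd on_test (EAnd (ENot continues) (ELeft item))) (ERight (ERight item))"

definition body_middle :: exp where
  "body_middle =
     filter_body f_middle (EAnd (ENot starts_after) continues) (ERight (ERight item))"

definition body_bottom :: exp where
  "body_bottom =
     filter_body f_bottom (EAnd on_test (EAnd (ENot continues) (ENot (ELeft item))))
       (ERight (ERight item))"

text \<open>The first argument counts the remaining edges down while the second counts stations up.
  The right end is built from bottom to top through the accumulators, which avoids
  appending.\<close>

definition body_edges :: exp where
  "body_edges =
     EIf (EVar 0)
       (ENode
         (ENode (ECall f_left [EVar 2, EVar 1, ELeaf])
           (ECall f_top [EVar 2, EVar 1, ECall f_middle [EVar 2, EVar 1,
             ECall f_bottom [EVar 2, EVar 1, ELeaf]]]))
         (ECall f_edges [ERight (EVar 0), ENode ELeaf (EVar 1), EVar 2]))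
       ELeaf"

text \<open>\<open>ERight (EVar 0)\<close> is the number \<open>n - 1\<close> of edges, and
  \<open>ETrue\<close> serves as the unary number 1, the first station.\<close>

definition body_output :: exp where
  "body_output =
     ECall f_edges [ERight (EVar 0), ETrue, ECall f_sort [ECall f_exits [EVar 1, EVar 1, ELeaf]]]"

definition solver :: program where
  "solver =
     [body_main, body_less, body_placed, body_above, body_below, body_min, body_add,
      body_cost, body_better, body_search, body_exits, body_entry, body_insert, body_sort,
      body_left, body_top, body_middle, body_bottom, body_edges, body_output]"

lemma solver_nth:
  "solver ! 0 = body_main"
  "solver ! (Suc 0) = body_less"
  "solver ! 2 = body_placed"
  "solver ! 3 = body_above"
  "solver ! 4 = body_below"
  "solver ! 5 = body_min"
  "solver ! 6 = body_add"
  "solver ! 7 = body_cost"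
  "solver ! 8 = body_better"
  "solver ! 9 = body_search"
  "solver ! 10 = body_exits"
  "solver ! 11 = body_entry"
  "solver ! 12 = body_insert"
  "solver ! 13 = body_sort"
  "solver ! 14 = body_left"
  "solver ! 15 = body_top"
  "solver ! 16 = body_middle"
  "solver ! 17 = body_bottom"
  "solver ! 18 = body_edges"
  "solver ! 19 = body_output"
  by (simp_all add: solver_def)

section \<open>Correctness and running time of the program\<close>

abbreviation "result y T \<equiv> \<lambda>y' t. y' = y \<and> t \<le> (T :: nat)"

lemma length_solver: "length solver = 20"
  by (simp add: solver_def)

lemma solver_runsI:
  "f < 20 \<Longrightarrow> wp solver xs (solver ! f) (result y T) \<Longrightarrow> runs solver f xs y T"
  by (simp add: runs_def wp_call_def length_solver)

text \<open>\<open>K\<close> bounds the test and the emitted expression on one element, for an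
  arbitrary unread rest \<open>u\<close>. The result is given by an equation so that it can be
  matched up to simplification.\<close>

lemma runs_filter_body:
  assumes f: "f < 20" "solver ! f = filter_body f test emit"
    and "\<And>s u. s \<in> set S \<Longrightarrow> wp solver [Node (g s) u, c, enc_list h ys] test (result (enc_bool (R s)) K)"
    and "\<And>s u. s \<in> set S \<Longrightarrow> R s \<Longrightarrow> wp solver [Node (g s) u, c, enc_list h ys] emit (result (h s) K)"
    and "y = enc_list h (filter R S @ ys)"
    and "length S \<le> N"
  shows "runs solver f [enc_list g S, c, enc_list h ys] y (N * (2 * K + 20) + 3)"
proof -
  have "runs solver f [enc_list g S, c, enc_list h ys] (enc_list h (filter R S @ ys))
    (length S * (2 * K + 20) + 3)" using assms(3,4)
  proof (induction S)
    case Nil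
    then show ?case using f by (auto intro!: solver_runsI simp: filter_body_def)
  next
    case (Cons s S)
    let ?u = "enc_list g S"
    have IH: "runs solver f [?u, c, enc_list h ys] (enc_list h (filter R S @ ys))
      (length S * (2 * K + 20) + 3)" using Cons by simp
    have t: "wp solver [Node (g s) ?u, c, enc_list h ys] test (result (enc_bool (R s)) K)"
      using Cons.prems by simp
    show ?case
    proof (cases "R s")
      case True
      then have e: "wp solver [Node (g s) ?u, c, enc_list h ys] emit (result (h s) K)"
        using Cons.prems by simp
      show ?thesis using f(1)
        by (rule solver_runsI)
          (auto simp: f(2) filter_body_def True intro!: wp_mono[OF t] wp_mono[OF e] wp_callI[OF IH])
    next
      case False
      show ?thesis using f(1)
        by (rule solver_runsI)
          (auto simp: f(2) filter_body_def False intro!: wp_mono[OF t] wp_callI[OF IH])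
    qed
  qed
  moreover have "length S * (2 * K + 20) \<le> N * (2 * K + 20)" using assms(6) by (rule mult_le_mono1)
  ultimately show ?thesis using assms(5) by (auto elim!: runs_mono)
qed

text \<open>The recursion stops at the latest when the first number is used up, so later uses have
  to bound only that one.\<close>

lemma runs_less: "runs solver f_less [enc_nat m, enc_nat n] (enc_bool (m < n)) (10 * m + 10)"
proof (induction m arbitrary: n)
  case 0
  then show ?case by (intro solver_runsI) (auto simp: solver_nth body_less_def)
next
  case (Suc m)
  show ?case
    by (intro solver_runsI) (auto simp: solver_nth body_less_def intro!: wp_callI[OF Suc])
qed

definition bounded_line :: "nat \<Rightarrow> line \<Rightarrow> bool" where
  "bounded_line N l \<longleftrightarrow> fst l \<le> N \<and> snd l \<le> N"

text \<open>One parameter \<open>N\<close> will bound stations, \<open>n\<close> and the number of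
  lines at once; the constants are generous.\<close>

definition time_placed :: "nat \<Rightarrow> nat" where "time_placed N = 20 * N + 60"
definition time_count :: "nat \<Rightarrow> nat" where
  "time_count N = N * (2 * (20 * N + time_placed N + 60) + 20) + 3"
definition time_cost :: "nat \<Rightarrow> nat" where
  "time_cost N = N * (2 * time_count N + 20 * N + 80) + 5"
text \<open>The quadratic term pays for comparing unary costs, which reach at most
  \<open>N * N\<close> by \<open>exit_cost_le\<close>.\<close>

definition time_better :: "nat \<Rightarrow> nat" where
  "time_better N = 2 * time_cost N + 10 * (N * N) + 30"
definition time_exits :: "nat \<Rightarrow> nat" where
  "time_exits N = N * (2 * (2 * time_count N + 10 * N + 50) + 20) + 3"
definition time_entry :: "nat \<Rightarrow> nat" where "time_entry N = 2 * time_placed N + 10 * N + 60"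
definition time_insert :: "nat \<Rightarrow> nat" where "time_insert N = N * (time_entry N + 20) + 10"
definition time_sort :: "nat \<Rightarrow> nat" where "time_sort N = N * (time_insert N + 20) + 5"
definition time_select :: "nat \<Rightarrow> nat" where "time_select N = N * (2 * (40 * N + 120) + 20) + 3"
definition time_edges :: "nat \<Rightarrow> nat" where "time_edges N = N * (4 * time_select N + 60) + 5"
definition time_output :: "nat \<Rightarrow> nat" where
  "time_output N = time_exits N + time_sort N + time_edges N + 30"

section \<open>Cost of a choice of starting sides\<close>

lemma runs_placed:
  assumes "bounded_line N p" "bounded_line N l"
  shows "runs solver f_placed [enc1 x p, enc1 x l] (enc_bool (placed_above x p l)) (time_placed N)"
  using assms
  by (intro solver_runsI)
    (auto simp: solver_nth body_placed_def placed_above_def bounded_line_def time_placed_def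
      intro!: wp_callI[OF runs_less])

lemma runs_above:
  assumes "distinct S" "length S \<le> N" "\<forall>s \<in> set S. bounded_line N s" "bounded_line N l"
  shows "runs solver f_above [enc_list (enc1 x) S, enc1 x l, Leaf]
    (enc_nat (card (lines_above x (set S) l))) (time_count N)"
proof -
  let ?R = "\<lambda>p. passes_through p (snd l) \<and> placed_above x p l"
  \<comment> \<open>Distinctness turns the cardinality into the length of the filtered list, which
    the loop produces in unary.\<close>
  have "{p \<in> set S. ?R p} = set (filter ?R S)" by auto
  then have "card (lines_above x (set S) l) = length (filter ?R S)"
    unfolding lines_above_def using assms(1) by (metis distinct_card distinct_filter)
  moreover have "runs solver f_above [enc_list (enc1 x) S, enc1 x l, enc_list (\<lambda>_. Leaf) ([] :: line list)]
    (enc_list (\<lambda>_. Leaf) (filter ?R S)) (time_count N)"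
    unfolding time_count_def
    by (rule runs_filter_body[where R = ?R])
      (use assms in \<open>auto simp: solver_nth body_above_def passes_through_def bounded_line_def
        dest!: bspec intro!: wp_callI[OF runs_less] wp_callI[OF runs_placed[where N = N]]\<close>)
  ultimately show ?thesis by (simp add: enc_list_Leaf)
qed

lemma runs_below:
  assumes "distinct S" "length S \<le> N" "\<forall>s \<in> set S. bounded_line N s" "bounded_line N l"
  shows "runs solver f_below [enc_list (enc1 x) S, enc1 x l, Leaf]
    (enc_nat (card (lines_below x (set S) l))) (time_count N)"
proof -
  let ?R = "\<lambda>p. passes_through p (snd l) \<and> placed_above x l p"
  have "{p \<in> set S. ?R p} = set (filter ?R S)" by auto
  then have "card (lines_below x (set S) l) = length (filter ?R S)"
    unfolding lines_below_def using assms(1) by (metis distinct_card distinct_filter)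
  moreover have "runs solver f_below [enc_list (enc1 x) S, enc1 x l, enc_list (\<lambda>_. Leaf) ([] :: line list)]
    (enc_list (\<lambda>_. Leaf) (filter ?R S)) (time_count N)"
    unfolding time_count_def
    by (rule runs_filter_body[where R = ?R])
      (use assms in \<open>auto simp: solver_nth body_below_def passes_through_def bounded_line_def
        dest!: bspec intro!: wp_callI[OF runs_less] wp_callI[OF runs_placed[where N = N]]\<close>)
  ultimately show ?thesis by (simp add: enc_list_Leaf)
qed

lemma runs_min: "runs solver f_min [enc_nat m, enc_nat n] (enc_nat (min m n)) (10 * m + 20)"
  by (intro solver_runsI) (auto simp: solver_nth body_min_def intro!: wp_callI[OF runs_less])

lemma runs_add: "runs solver f_add [enc_nat m, enc_nat n] (enc_nat (m + n)) (10 * m + 10)"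
proof (induction m)
  case 0
  show ?case by (intro solver_runsI) (auto simp: solver_nth body_add_def)
next
  case (Suc m)
  show ?case by (intro solver_runsI) (auto simp: solver_nth body_add_def intro!: wp_callI[OF Suc])
qed

lemma card_lines_above_le: "card (lines_above x (set S) l) \<le> length S"
  and card_lines_below_le: "card (lines_below x (set S) l) \<le> length S"
proof -
  have "card B \<le> length S" if "B \<subseteq> set S" for B
    using card_mono[OF _ that] card_length[of S] by simp
  then show "card (lines_above x (set S) l) \<le> length S" "card (lines_below x (set S) l) \<le> length S"
    by (auto simp: lines_above_def lines_below_def)
qed

text \<open>For the induction the consumed list \<open>S\<close> is separated from the fixed list
  \<open>A\<close> against which lines are counted.\<close>

lemma runs_cost_aux:
  assumes "distinct A" "length A \<le> N" "\<forall>s \<in> set A. bounded_line N s" "set S \<subseteq> set A"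
  shows "runs solver f_cost [enc_list (enc1 x) S, enc_list (enc1 x) A]
    (enc_nat (\<Sum>l\<leftarrow>S. min (card (lines_above x (set A) l)) (card (lines_below x (set A) l))))
    (length S * (2 * time_count N + 20 * N + 80) + 5)"
  using assms(4)
proof (induction S)
  case Nil
  show ?case by (intro solver_runsI) (auto simp: solver_nth body_cost_def)
next
  case (Cons l S)
  have IH: "runs solver f_cost [enc_list (enc1 x) S, enc_list (enc1 x) A]
    (enc_nat (\<Sum>l\<leftarrow>S. min (card (lines_above x (set A) l)) (card (lines_below x (set A) l))))
    (length S * (2 * time_count N + 20 * N + 80) + 5)" using Cons by simp
  have l: "bounded_line N l" using Cons.prems assms by simp
  have le: "card (lines_above x (set A) l) \<le> N" using card_lines_above_le assms(2) le_trans by blast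
  then have "min (card (lines_above x (set A) l)) (card (lines_below x (set A) l)) \<le> N" by simp
  then show ?case using le
    by (intro solver_runsI)
      (auto simp: solver_nth body_cost_def simp del: min.bounded_iff
        intro!: wp_callI[OF IH] wp_callI[OF runs_add] wp_callI[OF runs_min]
          wp_callI[OF runs_above[OF assms(1-3) l]] wp_callI[OF runs_below[OF assms(1-3) l]])
qed

lemma runs_cost:
  assumes "distinct A" "length A \<le> N" "\<forall>s \<in> set A. bounded_line N s"
  shows "runs solver f_cost [enc_list (enc1 x) A, enc_list (enc1 x) A]
    (enc_nat (exit_cost x (set A))) (time_cost N)"
proof -
  have "length A * (2 * time_count N + 20 * N + 80) + 5 \<le> time_cost N"
    unfolding time_cost_def using assms(2) by (intro add_right_mono mult_le_mono1)
  then show ?thesis using runs_mono[OF runs_cost_aux[OF assms order.refl]] assms(1)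
    by (simp add: exit_cost_def sum_list_distinct_conv_sum_set)
qed

lemma exit_cost_le: "length A \<le> N \<Longrightarrow> exit_cost x (set A) \<le> N * N"
proof -
  assume N: "length A \<le> N"
  have "exit_cost x (set A) \<le> (\<Sum>l\<in>set A. N)"
    unfolding exit_cost_def by (rule sum_mono) (meson N card_lines_above_le le_trans min.coboundedI1)
  also have "\<dots> \<le> N * N" using N card_length[of A] by (simp add: mult_le_mono1)
  finally show ?thesis .
qed

section \<open>Search over the starting sides\<close>

lemma runs_better:
  assumes "distinct A" "length A \<le> N" "\<forall>s \<in> set A. bounded_line N s"
  shows "runs solver f_better [enc_list (enc1 u) A, enc_list (enc1 v) A]
    (enc_list (enc1 (if exit_cost v (set A) < exit_cost u (set A) then v else u)) A)
    (time_better N)"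
  using exit_cost_le[OF assms(2), of v]
  by (intro solver_runsI)
    (auto simp: solver_nth body_better_def time_better_def
      intro!: wp_callI[OF runs_less] wp_callI[OF runs_cost[OF assms]])

text \<open>The summand \<open>time_better N + 40\<close> on the left absorbs the work at the inner nodes of the
  search tree, so that the bound doubles exactly with each line.\<close>

lemma runs_search:
  assumes "distinct (rev S @ A)" "length S + length A \<le> N" "\<forall>s \<in> set S \<union> set A. bounded_line N s"
  shows "\<exists>u T. (\<forall>l \<in> set A. u l = x l) \<and>
     (\<forall>v. (\<forall>l \<in> set A. v l = x l) \<longrightarrow> exit_cost u (set S \<union> set A) \<le> exit_cost v (set S \<union> set A)) \<and>
     runs solver f_search [enc_list enc_line S, enc_list (enc1 x) A] (enc_list (enc1 u) (rev S @ A)) T \<and>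
     T + time_better N + 40 \<le> 2 ^ length S * (time_better N + 50)"
  using assms
proof (induction S arbitrary: A x)
  case Nil
  have "exit_cost x (set A) \<le> exit_cost v (set A)" if "\<forall>l \<in> set A. v l = x l" for v
  proof -
    have "placed_above x p q = placed_above v p q" if "p \<in> set A" "q \<in> set A" for p q
      using that \<open>\<forall>l \<in> set A. v l = x l\<close> by (simp add: placed_above_def)
    then have "exit_cost x (set A) = exit_cost v (set A)"
      unfolding exit_cost_def lines_above_def lines_below_def
      by (intro sum.cong refl arg_cong2[where f = min] arg_cong[where f = card]) auto
    then show ?thesis by simp
  qed
  \<comment> \<open>The time 10 makes the bound tight for the empty list: 50 is 10 + 40.\<close>
  moreover have "runs solver f_search [Leaf, enc_list (enc1 x) A] (enc_list (enc1 x) A) 10"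
    by (intro solver_runsI) (auto simp: solver_nth body_search_def)
  ultimately show ?case by (intro exI[of _ x] exI[of _ 10]) auto
next
  case (Cons s S)
  let ?L = "set S \<union> insert s (set A)"
  have pre: "distinct (rev S @ s # A)" "length S + length (s # A) \<le> N"
    "\<forall>l \<in> set S \<union> set (s # A). bounded_line N l" using Cons.prems by auto
  \<comment> \<open>Tagging \<open>s\<close> leaves the encoding of \<open>A\<close> unchanged, so
    both recursive calls are instances of the induction hypothesis at
    \<open>x(s := b)\<close>.\<close>
  have cong: "enc_list (enc1 (x(s := b))) (s # A) = Node (Node (enc_bool b) (enc_line s)) (enc_list (enc1 x) A)" for b
  proof -
    have "enc_list (enc1 (x(s := b))) B = enc_list (enc1 x) B" if "s \<notin> set B" for B
      using that by (induction B) (auto simp: enc1_def)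
    then show ?thesis using Cons.prems by (simp add: enc1_def)
  qed
  have IH: "\<exists>u T. (\<forall>l \<in> set A. u l = x l) \<and> u s = b \<and>
     (\<forall>v. (\<forall>l \<in> set A. v l = x l) \<longrightarrow> v s = b \<longrightarrow> exit_cost u ?L \<le> exit_cost v ?L) \<and>
     runs solver f_search [enc_list enc_line S, Node (Node (enc_bool b) (enc_line s)) (enc_list (enc1 x) A)]
       (enc_list (enc1 u) (rev S @ s # A)) T \<and>
     T + time_better N + 40 \<le> 2 ^ length S * (time_better N + 50)" for b
  proof -
    obtain u T where u: "\<forall>l \<in> set (s # A). u l = (x(s := b)) l"
      "\<forall>v. (\<forall>l \<in> set (s # A). v l = (x(s := b)) l) \<longrightarrow>
         exit_cost u (set S \<union> set (s # A)) \<le> exit_cost v (set S \<union> set (s # A))"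
      "runs solver f_search [enc_list enc_line S, enc_list (enc1 (x(s := b))) (s # A)]
         (enc_list (enc1 u) (rev S @ s # A)) T"
      "T + time_better N + 40 \<le> 2 ^ length S * (time_better N + 50)"
      using Cons.IH[OF pre, of "x(s := b)"] by blast
    have "s \<notin> set A" using Cons.prems by auto
    then have "(\<forall>l \<in> set A. u l = x l) \<and> u s = b" using u(1) by auto
    moreover have "exit_cost u ?L \<le> exit_cost v ?L" if "\<forall>l \<in> set A. v l = x l" "v s = b" for v
    proof -
      have "\<forall>l \<in> set (s # A). v l = (x(s := b)) l" using that \<open>s \<notin> set A\<close> by simp
      then show ?thesis using u(2) by simp
    qed
    ultimately show ?thesis using u(3,4) unfolding cong by blast
  qed
  obtain u T where u: "\<forall>l \<in> set A. u l = x l" "u s"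
     "\<And>v. \<forall>l \<in> set A. v l = x l \<Longrightarrow> v s \<Longrightarrow> exit_cost u ?L \<le> exit_cost v ?L"
     "runs solver f_search [enc_list enc_line S, Node (Node (Node Leaf Leaf) (enc_line s)) (enc_list (enc1 x) A)]
       (enc_list (enc1 u) (rev S @ s # A)) T"
     "T + time_better N + 40 \<le> 2 ^ length S * (time_better N + 50)"
    using IH[of True] by (auto simp: enc_bool_def)
  obtain v T' where v: "\<forall>l \<in> set A. v l = x l" "\<not> v s"
     "\<And>w. \<forall>l \<in> set A. w l = x l \<Longrightarrow> \<not> w s \<Longrightarrow> exit_cost v ?L \<le> exit_cost w ?L"
     "runs solver f_search [enc_list enc_line S, Node (Node Leaf (enc_line s)) (enc_list (enc1 x) A)]
       (enc_list (enc1 v) (rev S @ s # A)) T'"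
     "T' + time_better N + 40 \<le> 2 ^ length S * (time_better N + 50)"
    using IH[of False] by (auto simp: enc_bool_def)
  define w where "w = (if exit_cost v ?L < exit_cost u ?L then v else u)"
  have B: "runs solver f_better [enc_list (enc1 u) (rev S @ s # A), enc_list (enc1 v) (rev S @ s # A)]
    (enc_list (enc1 w) (rev S @ s # A)) (time_better N)"
    using runs_better[of "rev S @ s # A" N u v] pre unfolding w_def by auto
  have "runs solver f_search [enc_list enc_line (s # S), enc_list (enc1 x) A]
    (enc_list (enc1 w) (rev S @ s # A)) (T + T' + time_better N + 40)"
    by (intro solver_runsI)
      (auto simp: solver_nth body_search_def
        intro!: wp_callI[OF B] wp_callI[OF u(4)] wp_callI[OF v(4)])
  \<comment> \<open>A competitor \<open>w'\<close> belongs to the branch given by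
    \<open>w' s\<close>, whose optimum is at least as costly as \<open>w\<close>.\<close>
  moreover have "exit_cost w ?L \<le> exit_cost w' ?L" if "\<forall>l \<in> set A. w' l = x l" for w'
    using u(3)[OF that] v(3)[OF that] unfolding w_def by (cases "w' s") auto
  moreover have "\<forall>l \<in> set A. w l = x l" using u(1) v(1) by (simp add: w_def)
  moreover have "T + T' + time_better N + 40 + time_better N + 40 \<le> 2 ^ length (s # S) * (time_better N + 50)"
    using u(5) v(5) by simp
  ultimately show ?case by (intro exI[of _ w] exI[of _ "T + T' + time_better N + 40"]) auto
qed

section \<open>Exit sides and insertion sort\<close>

lemma runs_exits:
  assumes "distinct A" "length A \<le> N" "\<forall>s \<in> set A. bounded_line N s"
  shows "runs solver f_exits [enc_list (enc1 x) A, enc_list (enc1 x) A, Leaf]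
    (enc_list (enc2 x (exits_top x (set A))) A) (time_exits N)"
proof -
  have le: "card (lines_below x (set A) l) \<le> N" for l
    using card_lines_below_le assms(2) le_trans by blast
  let ?y = "exits_top x (set A)"
  have emit: "wp solver [Node (enc1 x s) u, enc_list (enc1 x) A, Leaf]
      (ENode (ENot (ELess (ECall f_below [EVar 1, item, ELeaf])
        (ECall f_above [EVar 1, item, ELeaf]))) item)
      (result (enc2 x ?y s) (2 * time_count N + 10 * N + 50))" if "s \<in> set A" for s u
  proof -
    have s: "bounded_line N s" using assms(3) that by simp
    show ?thesis
      using le[of s]
      by (auto simp: enc2_def exits_top_def intro!: wp_callI[OF runs_less]
          wp_callI[OF runs_above[OF assms s]] wp_callI[OF runs_below[OF assms s]])
  qed
  have "runs solver f_exits [enc_list (enc1 x) A, enc_list (enc1 x) A, enc_list (enc2 x ?y) []]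
    (enc_list (enc2 x ?y) A) (time_exits N)"
    unfolding time_exits_def using emit assms(2)
    by (intro runs_filter_body[where R = "\<lambda>_. True", OF _ solver_nth(11)[unfolded body_exits_def]])
      simp_all
  then show ?thesis by simp
qed

lemma runs_entry:
  assumes "bounded_line N p" "bounded_line N l"
  shows "runs solver f_entry [enc2 x y p, enc2 x y l] (enc_bool (entry_above x y p l)) (time_entry N)"
  using assms
  by (intro solver_runsI)
    (auto simp: solver_nth body_entry_def entry_above_def bounded_line_def time_entry_def
      intro!: wp_callI[OF runs_less] wp_callI[OF runs_placed[where N = N]])

fun insert_by :: "('a \<Rightarrow> 'a \<Rightarrow> bool) \<Rightarrow> 'a \<Rightarrow> 'a list \<Rightarrow> 'a list" where
  "insert_by R l [] = [l]"
| "insert_by R l (p # ps) = (if R p l then p # insert_by R l ps else l # p # ps)"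

definition sort_by :: "('a \<Rightarrow> 'a \<Rightarrow> bool) \<Rightarrow> 'a list \<Rightarrow> 'a list" where
  "sort_by R xs = foldr (insert_by R) xs []"

lemma sort_by_simps [simp]: "sort_by R [] = []" "sort_by R (x # xs) = insert_by R x (sort_by R xs)"
  by (simp_all add: sort_by_def)

lemma set_insert_by [simp]: "set (insert_by R l ps) = insert l (set ps)"
  by (induction ps) auto

lemma length_insert_by [simp]: "length (insert_by R l ps) = Suc (length ps)"
  by (induction ps) auto

lemma distinct_insert_by [simp]: "distinct (insert_by R l ps) \<longleftrightarrow> l \<notin> set ps \<and> distinct ps"
  by (induction ps) auto

lemma set_sort_by [simp]: "set (sort_by R xs) = set xs"
  by (induction xs) auto

lemma length_sort_by [simp]: "length (sort_by R xs) = length xs"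
  by (induction xs) auto

lemma distinct_sort_by [simp]: "distinct (sort_by R xs) \<longleftrightarrow> distinct xs"
  by (induction xs) auto

text \<open>A failed comparison with the head is reversed by totality, and transitivity extends it
  to the tail; distinctness supplies the inequalities for both laws.\<close>

lemma sorted_insert_by_entry_above:
  "distinct ps \<Longrightarrow> l \<notin> set ps \<Longrightarrow> sorted_wrt (entry_above x y) ps \<Longrightarrow>
     sorted_wrt (entry_above x y) (insert_by (entry_above x y) l ps)"
proof (induction ps)
  case (Cons p ps)
  show ?case
  proof (cases "entry_above x y p l")
    case True
    then show ?thesis using Cons by simp
  next
    case False
    have "p \<noteq> l" using Cons.prems by auto
    with False have lp: "entry_above x y l p" using entry_above_total by blast
    have "entry_above x y l q" if q: "q \<in> set ps" for q
    proof (rule entry_above_trans[OF lp])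
      show "entry_above x y p q" using q Cons.prems by simp
      show "l \<noteq> p" "p \<noteq> q" "l \<noteq> q" using q Cons.prems by auto
    qed
    with lp False Cons.prems show ?thesis by simp
  qed
qed simp

lemma sorted_sort_by_entry_above:
  "distinct xs \<Longrightarrow> sorted_wrt (entry_above x y) (sort_by (entry_above x y) xs)"
  by (induction xs) (simp_all add: sorted_insert_by_entry_above)

lemma runs_insert_aux:
  assumes "\<forall>s \<in> set ps. bounded_line N s" "bounded_line N l"
  shows "runs solver f_insert [enc2 x y l, enc_list (enc2 x y) ps]
    (enc_list (enc2 x y) (insert_by (entry_above x y) l ps)) (length ps * (time_entry N + 20) + 10)"
  using assms(1)
proof (induction ps)
  case Nil
  show ?case by (intro solver_runsI) (auto simp: solver_nth body_insert_def)
next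
  case (Cons p ps)
  have IH: "runs solver f_insert [enc2 x y l, enc_list (enc2 x y) ps]
    (enc_list (enc2 x y) (insert_by (entry_above x y) l ps)) (length ps * (time_entry N + 20) + 10)"
    using Cons by simp
  have p: "bounded_line N p" using Cons.prems by simp
  show ?case
    by (intro solver_runsI)
      (auto simp: solver_nth body_insert_def
        intro!: wp_callI[OF runs_entry[OF p assms(2)]] wp_callI[OF IH])
qed

lemma runs_insert:
  assumes "\<forall>s \<in> set ps. bounded_line N s" "bounded_line N l" "length ps \<le> N"
  shows "runs solver f_insert [enc2 x y l, enc_list (enc2 x y) ps]
    (enc_list (enc2 x y) (insert_by (entry_above x y) l ps)) (time_insert N)"
  using runs_mono[OF runs_insert_aux[OF assms(1,2)]] assms(3)
  by (simp add: time_insert_def mult_le_mono1)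

lemma runs_sort_aux:
  assumes "\<forall>s \<in> set S. bounded_line N s" "length S \<le> N"
  shows "runs solver f_sort [enc_list (enc2 x y) S]
    (enc_list (enc2 x y) (sort_by (entry_above x y) S)) (length S * (time_insert N + 20) + 5)"
  using assms
proof (induction S)
  case Nil
  show ?case by (intro solver_runsI) (auto simp: solver_nth body_sort_def)
next
  case (Cons l S)
  have IH: "runs solver f_sort [enc_list (enc2 x y) S]
    (enc_list (enc2 x y) (sort_by (entry_above x y) S)) (length S * (time_insert N + 20) + 5)"
    using Cons by simp
  have I: "runs solver f_insert [enc2 x y l, enc_list (enc2 x y) (sort_by (entry_above x y) S)]
    (enc_list (enc2 x y) (insert_by (entry_above x y) l (sort_by (entry_above x y) S))) (time_insert N)"
    using Cons.prems by (intro runs_insert) auto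
  show ?case
    by (intro solver_runsI)
      (auto simp: solver_nth body_sort_def intro!: wp_callI[OF I] wp_callI[OF IH])
qed

lemma runs_sort:
  assumes "\<forall>s \<in> set S. bounded_line N s" "length S \<le> N"
  shows "runs solver f_sort [enc_list (enc2 x y) S]
    (enc_list (enc2 x y) (sort_by (entry_above x y) S)) (time_sort N)"
  using runs_mono[OF runs_sort_aux[OF assms]] assms(2)
  by (simp add: time_sort_def mult_le_mono1)

section \<open>Output of the layout\<close>

lemma runs_select:
  assumes S: "length S \<le> N" "i \<le> N"
  shows "runs solver f_left [enc_list (enc2 x y) S, enc_nat i, Leaf]
      (enc_list enc_line (filter (on_edge i) S)) (time_select N)" (is ?left)
    and "runs solver f_top [enc_list (enc2 x y) S, enc_nat i, enc_list enc_line ys]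
      (enc_list enc_line (filter (\<lambda>l. on_edge i l \<and> \<not> Suc i < snd l \<and> y l) S @ ys))
      (time_select N)" (is ?top)
    and "runs solver f_middle [enc_list (enc2 x y) S, enc_nat i, enc_list enc_line ys]
      (enc_list enc_line (filter (\<lambda>l. \<not> i < fst l \<and> Suc i < snd l) S @ ys))
      (time_select N)" (is ?middle)
    and "runs solver f_bottom [enc_list (enc2 x y) S, enc_nat i, Leaf]
      (enc_list enc_line (filter (\<lambda>l. on_edge i l \<and> \<not> Suc i < snd l \<and> \<not> y l) S))
      (time_select N)" (is ?bottom)
proof -
  \<comment> \<open>In all four loops the first operand of each comparison is \<open>i\<close> or
    \<open>Suc i\<close>, so bounding \<open>i\<close> suffices.\<close>
  have "runs solver f_left [enc_list (enc2 x y) S, enc_nat i, enc_list enc_line []]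
      (enc_list enc_line (filter (on_edge i) S)) (time_select N)"
    unfolding time_select_def
    by (rule runs_filter_body[where R = "on_edge i"])
      (use S in \<open>auto simp: solver_nth body_left_def on_edge_def intro!: wp_callI[OF runs_less]\<close>)
  then show ?left by simp
  have "runs solver f_bottom [enc_list (enc2 x y) S, enc_nat i, enc_list enc_line []]
      (enc_list enc_line (filter (\<lambda>l. on_edge i l \<and> \<not> Suc i < snd l \<and> \<not> y l) S))
      (time_select N)"
    unfolding time_select_def
    by (rule runs_filter_body[where R = "\<lambda>l. on_edge i l \<and> \<not> Suc i < snd l \<and> \<not> y l"])
      (use S in \<open>auto simp: solver_nth body_bottom_def on_edge_def intro!: wp_callI[OF runs_less]\<close>)
  then show ?bottom by simp
  show ?top
    unfolding time_select_def
    by (rule runs_filter_body[where R = "\<lambda>l. on_edge i l \<and> \<not> Suc i < snd l \<and> y l"])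
      (use S in \<open>auto simp: solver_nth body_top_def on_edge_def intro!: wp_callI[OF runs_less]\<close>)
  show ?middle
    unfolding time_select_def
    by (rule runs_filter_body[where R = "\<lambda>l. \<not> i < fst l \<and> Suc i < snd l"])
      (use S in \<open>auto simp: solver_nth body_middle_def on_edge_def intro!: wp_callI[OF runs_less]\<close>)
qed

abbreviation "enc_edge \<equiv> enc_pair (enc_list enc_line) (enc_list enc_line)"

text \<open>The bound \<open>Suc N\<close> admits the call with \<open>i = 1\<close> and
  \<open>r = 0\<close> even for \<open>N = 0\<close>.\<close>

lemma runs_edges_aux:
  assumes "length S \<le> N" "i + r \<le> Suc N"
  shows "runs solver f_edges [enc_nat r, enc_nat i, enc_list (enc2 x y) S]
    (enc_list enc_edge (map (sweep_layout y S) [i..<i + r])) (r * (4 * time_select N + 60) + 5)"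
  using assms(2)
proof (induction r arbitrary: i)
  case 0
  show ?case by (intro solver_runsI) (auto simp: solver_nth body_edges_def)
next
  case (Suc r)
  have i: "i \<le> N" using Suc.prems by simp
  define rest where "rest = enc_list enc_edge (map (sweep_layout y S) [Suc i..<Suc i + r])"
  have IH: "runs solver f_edges [enc_nat r, enc_nat (Suc i), enc_list (enc2 x y) S] rest
    (r * (4 * time_select N + 60) + 5)"
    unfolding rest_def using Suc.prems by (intro Suc.IH) simp
  have "[i..<i + Suc r] = i # [Suc i..<Suc i + r]" by (simp add: upt_conv_Cons)
  then have enc: "enc_list enc_edge (map (sweep_layout y S) [i..<i + Suc r]) =
      Node (enc_edge (sweep_layout y S i)) rest"
    by (simp only: rest_def list.map enc_list.simps)
  note sel = runs_select[OF assms(1) i, where x = x and y = y]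
  show ?case unfolding enc
    by (intro solver_runsI)
      (auto simp: solver_nth body_edges_def enc_pair_def sweep_layout_def
        intro!: wp_callI[OF IH] wp_callI[OF sel(1)] wp_callI[OF sel(2)] wp_callI[OF sel(3)]
          wp_callI[OF sel(4)])
qed

lemma runs_output:
  fixes x :: "line \<Rightarrow> bool"
  assumes "distinct A" "length A \<le> N" "\<forall>s \<in> set A. bounded_line N s" "n \<le> N"
  defines "y \<equiv> exits_top x (set A)"
  shows "runs solver f_output [enc_nat n, enc_list (enc1 x) A]
    (enc_layout n (sweep_layout y (sort_by (entry_above x y) A))) (time_output N)"
proof -
  let ?S = "sort_by (entry_above x y) A"
  \<comment> \<open>For \<open>n = 0\<close> the truncated difference is 0 and both intervals are
    empty.\<close>
  have "[1..<1 + (n - 1)] = [1..<n]" by (cases n) auto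
  moreover have "(n - 1) * (4 * time_select N + 60) + 5 \<le> time_edges N"
    unfolding time_edges_def using assms(4) by (intro add_right_mono mult_le_mono1) simp
  ultimately have E: "runs solver f_edges [enc_nat (n - 1), Node Leaf Leaf, enc_list (enc2 x y) ?S]
    (enc_layout n (sweep_layout y ?S)) (time_edges N)"
    using runs_mono[OF runs_edges_aux[of ?S N 1 "n - 1" x y]] assms(2,4)
    by (simp add: enc_layout_def enc_nat.simps)
  show ?thesis
    by (intro solver_runsI)
      (auto simp: solver_nth body_output_def time_output_def
        intro!: wp_callI[OF E[simplified]] wp_callI[OF runs_sort[OF assms(3,2)]]
          wp_callI[OF runs_exits[OF assms(1-3), of x, folded y_def]])
qed

section \<open>Polynomial bounds and the final estimate\<close>

definition is_poly :: "(nat \<Rightarrow> nat) \<Rightarrow> bool" where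
  "is_poly f \<longleftrightarrow> (\<exists>p. \<forall>N. f N = poly p N)"

text \<open>The rules follow the shape of the time bounds, so no polynomial has to be written
  out.\<close>

lemma is_poly_intros:
  "is_poly (\<lambda>N. c)" "is_poly (\<lambda>N. N)"
  "is_poly f \<Longrightarrow> is_poly g \<Longrightarrow> is_poly (\<lambda>N. f N + g N)"
  "is_poly f \<Longrightarrow> is_poly g \<Longrightarrow> is_poly (\<lambda>N. f N * g N)"
proof -
  show "is_poly (\<lambda>N. c)" unfolding is_poly_def by (rule exI[of _ "[:c:]"]) simp
  show "is_poly (\<lambda>N. N)" unfolding is_poly_def by (rule exI[of _ "[:0, 1:]"]) simp
  show "is_poly (\<lambda>N. f N + g N)" if "is_poly f" "is_poly g"
    using that unfolding is_poly_def by (metis poly_add)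
  show "is_poly (\<lambda>N. f N * g N)" if "is_poly f" "is_poly g"
    using that unfolding is_poly_def by (metis poly_mult)
qed

theorem theorem3:
  "\<exists>(P :: program) (p :: nat poly). \<forall>(n :: nat) (L :: line set) (ls :: line list).
     mlcm_instance n L \<and> distinct ls \<and> set ls = L \<longrightarrow>
       (\<exists>lay t. computes_in P (enc_instance n ls) (enc_layout n lay) t \<and>
                mlcm_p_optimal n L lay \<and>
                t \<le> 2 ^ card L * poly p (input_size n L))"
proof -
  \<comment> \<open>70 is the 50 of the search bound plus 20 for \<open>body_main\<close>.\<close>
  have "is_poly (\<lambda>N. time_better N + time_output N + 70)"
    unfolding time_output_def time_edges_def time_select_def time_sort_def time_insert_def
      time_entry_def time_exits_def time_better_def time_cost_def time_count_def time_placed_def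
    by (intro is_poly_intros)
  then obtain p where p: "\<And>N. poly p N = time_better N + time_output N + 70"
    unfolding is_poly_def by metis
  have "\<exists>lay t. computes_in solver (enc_instance n ls) (enc_layout n lay) t \<and>
      mlcm_p_optimal n L lay \<and> t \<le> 2 ^ card L * poly p (input_size n L)"
    if inst: "mlcm_instance n L" and ls: "distinct ls" "set ls = L" for n L ls
  proof -
    define N where "N = input_size n L"
    have len: "length ls = card L" using ls distinct_card by fastforce
    have bnd: "\<forall>s \<in> set ls. bounded_line N s"
      using inst ls(2) by (fastforce simp: mlcm_instance_def bounded_line_def N_def input_size_def)
    have N: "n \<le> N" "length ls \<le> N" by (auto simp: N_def input_size_def len)
    \<comment> \<open>With an empty accumulator the agreement condition is vacuous, so
      \<open>x\<close> is a global minimizer; the initial sides are arbitrary.\<close>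
    obtain x T where x: "\<And>v. exit_cost x L \<le> exit_cost v L"
      "runs solver f_search [enc_list enc_line ls, Leaf] (enc_list (enc1 x) (rev ls)) T"
      "T + time_better N + 40 \<le> 2 ^ card L * (time_better N + 50)"
      using runs_search[of ls "[]" N "\<lambda>_. True"] ls bnd N len by auto
    define y where "y = exits_top x L"
    define lay where "lay = sweep_layout y (sort_by (entry_above x y) (rev ls))"
    have O: "runs solver f_output [enc_nat n, enc_list (enc1 x) (rev ls)] (enc_layout n lay)
      (time_output N)"
      using runs_output[of "rev ls" N n x] ls bnd N by (simp add: lay_def y_def)
    have "runs solver 0 [enc_instance n ls] (enc_layout n lay) (T + time_output N + 20)"
      by (intro solver_runsI)
        (auto simp: solver_nth body_main_def enc_instance_def enc_pair_def
          intro!: wp_callI[OF O] wp_callI[OF x(2)])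
    then obtain t where t: "eval solver [enc_instance n ls] (solver ! 0) (enc_layout n lay) t"
      "t \<le> T + time_output N + 20"
      by (auto simp: runs_def wp_call_def wp_def)
    have "mlcm_p_optimal n L lay"
      unfolding lay_def y_def
      using inst x(1) ls sorted_sort_by_entry_above[of "rev ls" x "exits_top x L"]
      by (intro sweep_layout_optimal) auto
    \<comment> \<open>The output phase runs only once and is absorbed because the power of two is at
      least 1.\<close>
    moreover have "time_output N + 20 \<le> 2 ^ card L * (time_output N + 20)" by simp
    then have "T + time_output N + 20 \<le> 2 ^ card L * (time_better N + time_output N + 70)"
      using x(3) by (simp add: algebra_simps)
    then have "t \<le> 2 ^ card L * poly p (input_size n L)"
      using t(2) by (simp add: p N_def)
    moreover have "computes_in solver (enc_instance n ls) (enc_layout n lay) t"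
      using t(1) by (simp add: computes_in_def solver_def)
    ultimately show ?thesis by blast
  qed
  then show ?thesis by blast
qed

end
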